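(* Let $G = \mathbf{Z}/m_1\mathbf{Z} \times \cdots \times \mathbf{Z}/m_d\mathbf{Z}$ be a finite abelian group, where $d \ge 1$ and $m_1,\ldots,m_d$ are integers greater than $1$, and let $\varphi$ be the canonical embedding of $G$ into the fundamental integer parallelepiped $P_G$ of the lattice $\Lambda_G$. Let $A$ be a nonempty subset of $G$ such that \[ |A+A| > |A-A|. \] Then for every sufficiently large integer $t$, the set of lattice points \[ B_t = \varphi(A) + \Lambda_G(0,t) \subseteq \mathbf{Z}^d \] satisfies the inequality \[ |B_t + B_t| > |B_t - B_t|. \]
   Context: For subsets $X,Y$ of an abelian group, $X+Y=\{x+y\}$ and $X-Y=\{x-y\}$ with $x\in X,y\in Y$; $|X|$ denotes cardinality. For $G = \mathbf{Z}/m_1\mathbf{Z} \times \cdots \times \mathbf{Z}/m_d\mathbf{Z}$: the lattice is $\Lambda_G = \{(q_1m_1,\ldots,q_dm_d) : q_i\in\mathbf{Z}\}\subseteq \mathbf{Z}^d$; the fundamental integer parallelepiped is $P_G = \{(r_1,\ldots,r_d)\in\mathbf{Z}^d : 0\le r_i\le m_i-1 \text{ for } i=1,\ldots,d\}$; the canonical embedding $\varphi: G\to P_G$ is $\varphi(u_1+m_1\mathbf{Z},\ldots,u_d+m_d\mathbf{Z}) = (r_1,\ldots,r_d)$, where $r_i$ is the unique integer with $r_i\equiv u_i \pmod{m_i}$ and $0\le r_i\le m_i-1$. For integers $s\le t$, $\Lambda_G(s,t) = \{(q_1m_1,\ldots,q_dm_d)\in\Lambda_G : s\le q_i<t \text{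 for } i=1,\ldots,d\}$. *)

theory Defs
  imports "HOL-Algebra.Product_Groups"
begin

text \<open>
  Tuples of length d are functions extensional on the index set {1..d}, as in
  product_group. Elements of Z/mZ are residue classes, that is, sets of integers;
  the library's integer_mod_group is not used because its elements already are
  canonical representatives, which would turn the canonical embedding into the identity.
\<close>

definition residue_group :: "int \<Rightarrow> int set monoid" where
  "residue_group m = integer_group Mod {m * k | k. True}"

definition residue_product :: "nat \<Rightarrow> (nat \<Rightarrow> int) \<Rightarrow> (nat \<Rightarrow> int set) monoid" where
  "residue_product d m = product_group {1..d} (\<lambda>i. residue_group (m i))"

definition integer_lattice :: "nat \<Rightarrow> (nat \<Rightarrow> int) monoid" where
  "integer_lattice d = product_group {1..d} (\<lambda>i. integer_group)"

text \<open>
  Abelian groups are written multiplicatively in HOL-Algebra, so the sumset is the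
  library's set_mult.
\<close>

abbreviation sumset :: "('a, 'b) monoid_scheme \<Rightarrow> 'a set \<Rightarrow> 'a set \<Rightarrow> 'a set" where
  "sumset G X Y \<equiv> X <#>\<^bsub>G\<^esub> Y"

definition diffset :: "('a, 'b) monoid_scheme \<Rightarrow> 'a set \<Rightarrow> 'a set \<Rightarrow> 'a set" where
  "diffset G X Y = {x \<otimes>\<^bsub>G\<^esub> inv\<^bsub>G\<^esub> y | x y. x \<in> X \<and> y \<in> Y}"

definition period_lattice :: "nat \<Rightarrow> (nat \<Rightarrow> int) \<Rightarrow> (nat \<Rightarrow> int) set" where
  "period_lattice d m = {(\<lambda>i\<in>{1..d}. q i * m i) | q. True}"

definition period_lattice_box :: "nat \<Rightarrow> (nat \<Rightarrow> int) \<Rightarrow> int \<Rightarrow> int \<Rightarrow> (nat \<Rightarrow> int) set" where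
  "period_lattice_box d m s t =
     {(\<lambda>i\<in>{1..d}. q i * m i) | q. \<forall>i\<in>{1..d}. s \<le> q i \<and> q i < t}"

definition parallelepiped :: "nat \<Rightarrow> (nat \<Rightarrow> int) \<Rightarrow> (nat \<Rightarrow> int) set" where
  "parallelepiped d m = (\<Pi>\<^sub>E i\<in>{1..d}. {0..m i - 1})"

text \<open>
  The i-th coordinate of x is a residue class modulo m i; its integer elements are exactly
  the integers congruent to any of its representatives.
\<close>

definition canonical_embedding :: "nat \<Rightarrow> (nat \<Rightarrow> int) \<Rightarrow> (nat \<Rightarrow> int set) \<Rightarrow> (nat \<Rightarrow> int)" where
  "canonical_embedding d m x =
     (\<lambda>i\<in>{1..d}. THE r. r \<in> x i \<and> 0 \<le> r \<and> r \<le> m i - 1)"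

definition periodic_lift ::
    "nat \<Rightarrow> (nat \<Rightarrow> int) \<Rightarrow> (nat \<Rightarrow> int set) set \<Rightarrow> int \<Rightarrow> (nat \<Rightarrow> int) set" where
  "periodic_lift d m A t =
     sumset (integer_lattice d) (canonical_embedding d m ` A) (period_lattice_box d m 0 t)"

lemma period_lattice_box_subset: "period_lattice_box d m s t \<subseteq> period_lattice d m"
  by (auto simp: period_lattice_box_def period_lattice_def)

lemma carrier_residue_group:
  "carrier (residue_group m) = {{u + m * k | k. True} | u. True}"
proof -
  have "{m * k | k. True} #>\<^bsub>integer_group\<^esub> u = {u + m * k | k. True}" for u
    by (auto simp: r_coset_def add.commute)
  then show ?thesis
    by (auto simp: residue_group_def carrier_FactGroup)
qed

lemma comm_group_residue_group: "comm_group (residue_group m)"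
proof -
  have "subgroup {m * k | k. True} integer_group"
  proof (rule group.subgroupI[OF group_integer_group])
    fix a assume "a \<in> {m * k | k. True}"
    then obtain k where k: "a = m * k" by blast
    then have "- a = m * (- k)" by simp
    then show "inv\<^bsub>integer_group\<^esub> a \<in> {m * k | k. True}"
      unfolding inv_integer_group by blast
  next
    fix a b assume "a \<in> {m * k | k. True}" "b \<in> {m * k | k. True}"
    then obtain k l where "a = m * k" "b = m * l" by blast
    then have "a + b = m * (k + l)" by (simp add: distrib_left)
    then show "a \<otimes>\<^bsub>integer_group\<^esub> b \<in> {m * k | k. True}"
      unfolding mult_integer_group by blast
  qed auto
  then show ?thesis
    unfolding residue_group_def
    by (rule comm_group.abelian_FactGroup[OF abelian_integer_group])
qed

lemma canonical_representative:
  fixes m :: int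
  assumes "m > 1"
  shows "(THE r. r \<in> {u + m * k | k. True} \<and> 0 \<le> r \<and> r \<le> m - 1) = u mod m"
proof (rule the_equality)
  have "u mod m = u + m * (- (u div m))"
    by (simp add: minus_mult_div_eq_mod [symmetric])
  then have "u mod m \<in> {u + m * k | k. True}" by blast
  moreover have "0 \<le> u mod m" "u mod m \<le> m - 1"
    using assms pos_mod_bound[of m u] by auto
  ultimately show "u mod m \<in> {u + m * k | k. True} \<and> 0 \<le> u mod m \<and> u mod m \<le> m - 1"
    by blast
next
  fix r assume "r \<in> {u + m * k | k. True} \<and> 0 \<le> r \<and> r \<le> m - 1"
  then obtain k where "r = u + m * k" "0 \<le> r" "r < m" by auto
  then show "r = u mod m"
    by (metis mod_mult_self2 mod_pos_pos_trivial)
qed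

lemma canonical_embedding_coset:
  assumes "\<And>i. i \<in> {1..d} \<Longrightarrow> m i > 1"
  shows "canonical_embedding d m (\<lambda>i\<in>{1..d}. {u i + m i * k | k. True})
         = (\<lambda>i\<in>{1..d}. u i mod m i)"
  unfolding canonical_embedding_def
proof (rule restrict_ext)
  fix i assume "i \<in> {1..d}"
  then show "(THE r. r \<in> (\<lambda>i\<in>{1..d}. {u i + m i * k | k. True}) i \<and> 0 \<le> r \<and> r \<le> m i - 1)
             = u i mod m i"
    using canonical_representative[OF assms, of i "u i"] by simp
qed

lemma carrier_residue_product:
  "carrier (residue_product d m)
   = {(\<lambda>i\<in>{1..d}. {u i + m i * k | k. True}) | u. True}" (is "?L = ?R")
proof
  show "?L \<subseteq> ?R"
  proof
    fix x assume "x \<in> ?L"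
    then have x: "x \<in> extensional {1..d}"
      and "\<forall>i\<in>{1..d}. \<exists>u. x i = {u + m i * k | k. True}"
      by (auto simp: residue_product_def PiE_iff carrier_residue_group)
    then obtain u where "\<forall>i\<in>{1..d}. x i = {u i + m i * k | k. True}"
      by metis
    then have "x = (\<lambda>i\<in>{1..d}. {u i + m i * k | k. True})"
      using x by (intro extensionalityI[of _ "{1..d}"]) auto
    then show "x \<in> ?R" by blast
  qed
  show "?R \<subseteq> ?L"
    by (auto simp: residue_product_def carrier_residue_group)
qed

lemma canonical_embedding_bij:
  assumes "\<And>i. i \<in> {1..d} \<Longrightarrow> m i > 1"
  shows "bij_betw (canonical_embedding d m) (carrier (residue_product d m)) (parallelepiped d m)"
proof (rule bij_betw_imageI)
  have emb: "canonical_embedding d m (\<lambda>i\<in>{1..d}. {u i + m i * k | k. True})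
             = (\<lambda>i\<in>{1..d}. u i mod m i)" for u
    using assms by (rule canonical_embedding_coset)
  show "inj_on (canonical_embedding d m) (carrier (residue_product d m))"
  proof (rule inj_onI)
    fix x y
    assume "x \<in> carrier (residue_product d m)" "y \<in> carrier (residue_product d m)"
      and eq: "canonical_embedding d m x = canonical_embedding d m y"
    then obtain u v where x: "x = (\<lambda>i\<in>{1..d}. {u i + m i * k | k. True})"
      and y: "y = (\<lambda>i\<in>{1..d}. {v i + m i * k | k. True})"
      unfolding carrier_residue_product by blast
    have "{u i + m i * k | k. True} = {v i + m i * k | k. True}" if i: "i \<in> {1..d}" for i
    proof -
      have "(\<lambda>i\<in>{1..d}. u i mod m i) = (\<lambda>i\<in>{1..d}. v i mod m i)"
        using eq unfolding x y emb .
      then have "u i mod m i = v i mod m i"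
        using i by (simp only: fun_eq_iff restrict_def) meson
      then have "m i dvd u i - v i"
        by (simp add: mod_eq_dvd_iff)
      then obtain c where "u i - v i = m i * c" ..
      then have c: "u i = v i + m i * c" by simp
      have "u i + m i * k = v i + m i * (c + k)" for k
        using c by (simp add: distrib_left)
      moreover have "v i + m i * k = u i + m i * (k - c)" for k
        using c by (simp add: right_diff_distrib)
      ultimately show ?thesis by (metis (lifting))
    qed
    then show "x = y" unfolding x y by (rule restrict_ext)
  qed
  show "canonical_embedding d m ` carrier (residue_product d m) = parallelepiped d m"
  proof
    show "canonical_embedding d m ` carrier (residue_product d m) \<subseteq> parallelepiped d m"
    proof
      fix r assume "r \<in> canonical_embedding d m ` carrier (residue_product d m)"
      then obtain u where r: "r = (\<lambda>i\<in>{1..d}. u i mod m i)"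
        unfolding carrier_residue_product using emb by auto
      have "u i mod m i \<in> {0..m i - 1}" if "i \<in> {1..d}" for i
        using assms[OF that] pos_mod_bound[of "m i" "u i"] by auto
      then show "r \<in> parallelepiped d m"
        unfolding r parallelepiped_def by simp
    qed
    show "parallelepiped d m \<subseteq> canonical_embedding d m ` carrier (residue_product d m)"
    proof
      fix r assume r: "r \<in> parallelepiped d m"
      have "(\<lambda>i\<in>{1..d}. r i mod m i) i = r i" if "i \<in> {1..d}" for i
      proof -
        have "r i \<in> {0..m i - 1}"
          using r that unfolding parallelepiped_def by (rule PiE_mem)
        then show ?thesis using that by (simp add: mod_pos_pos_trivial)
      qed
      moreover have "r \<in> extensional {1..d}"
        using r by (simp add: parallelepiped_def PiE_iff)
      ultimately have "(\<lambda>i\<in>{1..d}. r i mod m i) = r"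
        by (intro extensionalityI[of _ "{1..d}"]) auto
      then have "r = canonical_embedding d m (\<lambda>i\<in>{1..d}. {r i + m i * k | k. True})"
        unfolding emb by (rule sym)
      then show "r \<in> canonical_embedding d m ` carrier (residue_product d m)"
        unfolding carrier_residue_product by (rule image_eqI[where f = "canonical_embedding d m"]) blast
    qed
  qed
qed

end

theory Submission
  imports Defs Complex_Main
begin

text \<open>
  Every point of \<open>\<int>\<^sup>d\<close> is determined by its vector of residues and its vector of quotients
  modulo the \<open>m i\<close>. Write \<open>C = \<phi>(A) + \<phi>(A)\<close> and \<open>D = \<phi>(A) - \<phi>(A)\<close>. Since \<open>\<phi>\<close> is a
  bijection onto the parallelepiped, the reduced sets \<open>C mod m\<close> and \<open>D mod m\<close> have
  \<open>|A + A|\<close> and \<open>|A - A|\<close> elements (\<open>card_sumset_residue_product\<close>,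
  \<open>card_diffset_residue_product\<close>).

  The sumset of the lift contains \<open>C + \<Lambda>(0, 2t - 1)\<close>. Fixing one point of \<open>C\<close> over each of
  its residue vectors gives \<open>|A + A| (2t - 1)\<^sup>d\<close> different points
  (\<open>card_residues_times_box_le\<close>). The difference set of the lift lies in
  \<open>D + \<Lambda>(1 - t, t)\<close>, and the points of \<open>D\<close> have quotients in \<open>{-1, 0}\<close>; so there are
  only \<open>2t\<close> possible quotients in each coordinate, and at most \<open>|A - A| (2t)\<^sup>d\<close> points
  (\<open>card_plus_box_le\<close>). As \<open>((2t - 1) / 2t)\<^sup>d\<close> tends to 1, a strict inequality between the
  integers \<open>|A - A|\<close> and \<open>|A + A|\<close> passes to these bounds; Bernoulli's inequality gives an
  explicit threshold for \<open>t\<close> (\<open>power_ratio_bound\<close>).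
\<close>

section \<open>Operations on integer points\<close>

lemma sumset_integer_lattice:
  "sumset (integer_lattice d) X Y = {(\<lambda>i\<in>{1..d}. x i + y i) | x y. x \<in> X \<and> y \<in> Y}"
  by (auto simp: set_mult_def integer_lattice_def)

lemma diffset_integer_lattice:
  assumes "Y \<subseteq> extensional {1..d}"
  shows "diffset (integer_lattice d) X Y = {(\<lambda>i\<in>{1..d}. x i - y i) | x y. x \<in> X \<and> y \<in> Y}"
proof -
  have inv: "inv\<^bsub>integer_lattice d\<^esub> y = (\<lambda>i\<in>{1..d}. - y i)" if "y \<in> Y" for y
  proof -
    have "y \<in> carrier (integer_lattice d)"
      using that assms by (auto simp: integer_lattice_def PiE_iff)
    then show ?thesis
      by (simp add: integer_lattice_def)
  qed
  have "x \<otimes>\<^bsub>integer_lattice d\<^esub> inv\<^bsub>integer_lattice d\<^esub> y = (\<lambda>i\<in>{1..d}. x i - y i)"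
    if "y \<in> Y" for x y
    unfolding inv[OF that] by (auto simp: integer_lattice_def intro!: restrict_ext)
  then show ?thesis
    unfolding diffset_def by (metis (lifting))
qed

section \<open>Counting points by residues and quotients\<close>

text \<open>The coordinatewise reduction of an integer point modulo the \<open>m i\<close>.\<close>

definition residue_vector :: "nat \<Rightarrow> (nat \<Rightarrow> int) \<Rightarrow> (nat \<Rightarrow> int) \<Rightarrow> (nat \<Rightarrow> int)" where
  "residue_vector d m x = (\<lambda>i\<in>{1..d}. x i mod m i)"

lemma card_cube:
  "card (\<Pi>\<^sub>E i\<in>{1..d}. {u..<v :: int}) = nat (v - u) ^ d"
  by (simp add: card_PiE)

lemma period_lattice_box_eq_image:
  "period_lattice_box d m u v = (\<lambda>q. \<lambda>i\<in>{1..d}. q i * m i) ` (\<Pi>\<^sub>E i\<in>{1..d}. {u..<v})"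
  (is "_ = _ ` ?Q")
proof
  show "period_lattice_box d m u v \<subseteq> (\<lambda>q. \<lambda>i\<in>{1..d}. q i * m i) ` ?Q"
  proof
    fix p assume "p \<in> period_lattice_box d m u v"
    then obtain q where p: "p = (\<lambda>i\<in>{1..d}. q i * m i)"
      and q: "\<forall>i\<in>{1..d}. u \<le> q i \<and> q i < v"
      unfolding period_lattice_box_def by blast
    have "p = (\<lambda>i\<in>{1..d}. (restrict q {1..d}) i * m i)"
      unfolding p by (rule restrict_ext) simp
    moreover have "restrict q {1..d} \<in> ?Q" using q by auto
    ultimately show "p \<in> (\<lambda>q. \<lambda>i\<in>{1..d}. q i * m i) ` ?Q" by blast
  qed
  show "(\<lambda>q. \<lambda>i\<in>{1..d}. q i * m i) ` ?Q \<subseteq> period_lattice_box d m u v"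
    by (fastforce simp: period_lattice_box_def)
qed

lemma finite_period_lattice_box: "finite (period_lattice_box d m u v)"
  unfolding period_lattice_box_eq_image by (intro finite_imageI finite_PiE) auto

text \<open>
  Translating one point of \<open>X\<close> in each residue class by the box already gives this many points.
\<close>

lemma card_residues_times_box_le:
  assumes m: "\<And>i. i \<in> {1..d} \<Longrightarrow> m i \<noteq> 0" and "finite X"
  shows "card (residue_vector d m ` X) * nat (v - u) ^ d
         \<le> card (sumset (integer_lattice d) X (period_lattice_box d m u v))"
proof -
  let ?Q = "\<Pi>\<^sub>E i\<in>{1..d}. {u..<v}"
  define f where "f = inv_into X (residue_vector d m)"
  define g where "g = (\<lambda>(s, q). \<lambda>i\<in>{1..d}. f s i + q i * m i)"
  let ?B = "sumset (integer_lattice d) X (period_lattice_box d m u v)"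
  have f: "f s \<in> X" "residue_vector d m (f s) = s" if "s \<in> residue_vector d m ` X" for s
    using that unfolding f_def by (rule inv_into_into, rule f_inv_into_f)
  have fin: "finite ?B"
    using \<open>finite X\<close> finite_period_lattice_box by (simp add: set_mult_def)
  have inj: "inj_on g (residue_vector d m ` X \<times> ?Q)"
  proof (rule inj_onI, clarify)
    fix x q y r
    assume x: "x \<in> X" and y: "y \<in> X" and q: "q \<in> ?Q" and r: "r \<in> ?Q"
      and eq: "g (residue_vector d m x, q) = g (residue_vector d m y, r)"
    define s where "s = residue_vector d m x"
    define s' where "s' = residue_vector d m y"
    have fs: "residue_vector d m (f s) = s" "residue_vector d m (f s') = s'"
      using f(2) x y by (auto simp: s_def s'_def)
    have pt: "f s i + q i * m i = f s' i + r i * m i" if "i \<in> {1..d}" for i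
      using fun_cong[OF eq, of i] that by (simp add: g_def s_def s'_def)
    have "f s i mod m i = f s' i mod m i" if "i \<in> {1..d}" for i
      by (metis pt[OF that] mod_mult_self1)
    then have "residue_vector d m (f s) = residue_vector d m (f s')"
      unfolding residue_vector_def by (rule restrict_ext)
    then have "s = s'" using fs by simp
    moreover have "q = r"
    proof (rule PiE_ext[OF q r])
      fix i assume i: "i \<in> {1..d}"
      show "q i = r i" using pt[OF i] m[OF i] \<open>s = s'\<close> by simp
    qed
    ultimately show "residue_vector d m x = residue_vector d m y \<and> q = r"
      by (simp add: s_def s'_def)
  qed
  have sub: "g ` (residue_vector d m ` X \<times> ?Q) \<subseteq> ?B"
  proof
    fix p assume "p \<in> g ` (residue_vector d m ` X \<times> ?Q)"
    then obtain s q where s: "s \<in> residue_vector d m ` X" and q: "q \<in> ?Q"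
      and p: "p = (\<lambda>i\<in>{1..d}. f s i + q i * m i)"
      unfolding g_def by auto
    have "p = (\<lambda>i\<in>{1..d}. f s i + (\<lambda>i\<in>{1..d}. q i * m i) i)"
      unfolding p by (rule restrict_ext) simp
    moreover have "(\<lambda>i\<in>{1..d}. q i * m i) \<in> period_lattice_box d m u v"
      unfolding period_lattice_box_eq_image using q by blast
    ultimately show "p \<in> ?B"
      unfolding sumset_integer_lattice using f(1)[OF s] by blast
  qed
  have "card (residue_vector d m ` X \<times> ?Q) \<le> card ?B"
    by (rule card_inj_on_le[OF inj sub fin])
  then show ?thesis by (simp only: card_cartesian_product card_cube)
qed

text \<open>
  Translating by \<open>q\<close> periods adds \<open>q\<close> to the quotients, so if those of \<open>X\<close> lie in
  \<open>[l, h]\<close>, then those of \<open>X + \<Lambda>(u, v)\<close> lie in \<open>[u + l, v + h)\<close>.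
\<close>

lemma card_plus_box_le:
  assumes "finite X"
    and quot: "\<And>x i. x \<in> X \<Longrightarrow> i \<in> {1..d} \<Longrightarrow> l \<le> x i div m i \<and> x i div m i \<le> h"
    and Y: "Y \<subseteq> sumset (integer_lattice d) X (period_lattice_box d m u v)"
  shows "card Y \<le> card (residue_vector d m ` X) * nat (v + h - (u + l)) ^ d"
proof -
  let ?Q = "\<Pi>\<^sub>E i\<in>{1..d}. {u + l..<v + h}"
  define g where "g = (\<lambda>(s, q). \<lambda>i\<in>{1..d}. s i + q i * m i :: int)"
  have "finite ?Q" by (rule finite_PiE) auto
  then have fin: "finite (residue_vector d m ` X \<times> ?Q)" using \<open>finite X\<close> by simp
  have "Y \<subseteq> g ` (residue_vector d m ` X \<times> ?Q)"
  proof
    fix p assume "p \<in> Y"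
    then obtain x q where x: "x \<in> X" and q: "\<forall>i\<in>{1..d}. u \<le> q i \<and> q i < v"
      and p: "p = (\<lambda>i\<in>{1..d}. x i + (\<lambda>i\<in>{1..d}. q i * m i) i)"
      using Y unfolding sumset_integer_lattice period_lattice_box_def by blast
    define r where "r = (\<lambda>i\<in>{1..d}. x i div m i + q i)"
    have "r \<in> ?Q"
      using q quot[OF x] unfolding r_def by (fastforce simp: add.commute)
    moreover have "p = g (residue_vector d m x, r)"
      unfolding p g_def residue_vector_def r_def
      by (auto simp: distrib_right intro!: restrict_ext)
    ultimately show "p \<in> g ` (residue_vector d m ` X \<times> ?Q)" using x by blast
  qed
  then have "card Y \<le> card (residue_vector d m ` X \<times> ?Q)"
    by (rule surj_card_le[OF fin])
  then show ?thesis by (simp only: card_cartesian_product card_cube)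
qed

section \<open>Sumsets and difference sets of residue classes\<close>

text \<open>The tuple of residue classes represented by an integer point.\<close>

definition residue_class :: "nat \<Rightarrow> (nat \<Rightarrow> int) \<Rightarrow> (nat \<Rightarrow> int) \<Rightarrow> (nat \<Rightarrow> int set)" where
  "residue_class d m u = (\<lambda>i\<in>{1..d}. {u i + m i * k | k. True})"

lemma group_residue_product: "group (residue_product d m)"
  unfolding residue_product_def
  by (rule product_group) (rule comm_group.axioms(2)[OF comm_group_residue_group])

lemma mult_residue_class:
  "residue_class d m u \<otimes>\<^bsub>residue_product d m\<^esub> residue_class d m v
   = residue_class d m (\<lambda>i. u i + v i)"
proof -
  have "{a + n * k | k. True} \<otimes>\<^bsub>residue_group n\<^esub> {b + n * k | k. True}
        = {a + b + n * k | k. True}" for a b n :: int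
  proof -
    have "{x + y | x y. x \<in> {a + n * k | k. True} \<and> y \<in> {b + n * k | k. True}}
        = {a + b + n * k | k. True}" (is "?L = ?R")
    proof
      have "(a + n * k) + (b + n * l) = a + b + n * (k + l)" for k l
        by (simp add: distrib_left)
      then show "?L \<subseteq> ?R" by blast
      have "a + b + n * k = (a + n * k) + (b + n * 0)" for k by simp
      then show "?R \<subseteq> ?L" by blast
    qed
    moreover have "{a + n * k | k. True} \<otimes>\<^bsub>residue_group n\<^esub> {b + n * k | k. True}
        = {x + y | x y. x \<in> {a + n * k | k. True} \<and> y \<in> {b + n * k | k. True}}"
      unfolding residue_group_def FactGroup_def set_mult_def by auto
    ultimately show ?thesis by simp
  qed
  then show ?thesis
    by (auto simp: residue_class_def residue_product_def intro!: restrict_ext)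
qed

lemma residue_class_in_carrier: "residue_class d m u \<in> carrier (residue_product d m)"
  unfolding carrier_residue_product residue_class_def by blast

lemma inv_residue_class:
  "inv\<^bsub>residue_product d m\<^esub> residue_class d m u = residue_class d m (\<lambda>i. - u i)"
proof -
  interpret group "residue_product d m" by (rule group_residue_product)
  \<comment> \<open>The class of 0 is the identity because it is idempotent.\<close>
  have "residue_class d m (\<lambda>i. 0) \<otimes>\<^bsub>residue_product d m\<^esub> residue_class d m (\<lambda>i. 0)
    = residue_class d m (\<lambda>i. 0)"
    by (simp add: mult_residue_class)
  then have one: "residue_class d m (\<lambda>i. 0) = \<one>\<^bsub>residue_product d m\<^esub>"
    using residue_class_in_carrier by (metis r_cancel_one')
  show ?thesis
    by (rule inv_equality) (simp_all add: mult_residue_class one residue_class_in_carrier)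
qed

lemma canonical_embedding_residue_class:
  assumes "\<And>i. i \<in> {1..d} \<Longrightarrow> m i > 1"
  shows "canonical_embedding d m (residue_class d m u) = residue_vector d m u"
  unfolding residue_class_def residue_vector_def using assms by (rule canonical_embedding_coset)

lemma carrier_residue_class:
  assumes "x \<in> carrier (residue_product d m)"
  obtains u where "x = residue_class d m u"
  using assms unfolding carrier_residue_product residue_class_def by blast

lemma canonical_embedding_mult:
  assumes m: "\<And>i. i \<in> {1..d} \<Longrightarrow> m i > 1"
    and "a \<in> carrier (residue_product d m)" "b \<in> carrier (residue_product d m)"
  shows "canonical_embedding d m (a \<otimes>\<^bsub>residue_product d m\<^esub> b)
    = residue_vector d m
        (\<lambda>i\<in>{1..d}. canonical_embedding d m a i + canonical_embedding d m b i)"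
proof -
  obtain u v where ab: "a = residue_class d m u" "b = residue_class d m v"
    using assms carrier_residue_class by metis
  have emb: "canonical_embedding d m (residue_class d m w) = residue_vector d m w" for w
    using m by (rule canonical_embedding_residue_class)
  show ?thesis
    unfolding ab mult_residue_class emb residue_vector_def
    by (rule restrict_ext) (simp add: mod_add_eq)
qed

lemma canonical_embedding_mult_inv:
  assumes m: "\<And>i. i \<in> {1..d} \<Longrightarrow> m i > 1"
    and "a \<in> carrier (residue_product d m)" "b \<in> carrier (residue_product d m)"
  shows "canonical_embedding d m (a \<otimes>\<^bsub>residue_product d m\<^esub> inv\<^bsub>residue_product d m\<^esub> b)
    = residue_vector d m
        (\<lambda>i\<in>{1..d}. canonical_embedding d m a i - canonical_embedding d m b i)"
proof -
  obtain u v where ab: "a = residue_class d m u" "b = residue_class d m v"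
    using assms carrier_residue_class by metis
  have emb: "canonical_embedding d m (residue_class d m w) = residue_vector d m w" for w
    using m by (rule canonical_embedding_residue_class)
  show ?thesis
    unfolding ab inv_residue_class mult_residue_class emb residue_vector_def
    by (rule restrict_ext) (simp add: mod_diff_eq)
qed

lemma canonical_embedding_subset_extensional:
  "canonical_embedding d m ` A \<subseteq> extensional {1..d}"
  by (auto simp: canonical_embedding_def)

lemma card_canonical_embedding_image:
  assumes "\<And>i. i \<in> {1..d} \<Longrightarrow> m i > 1" and "S \<subseteq> carrier (residue_product d m)"
  shows "card (canonical_embedding d m ` S) = card S"
  using canonical_embedding_bij[of d m] assms
  by (intro card_image) (auto simp: bij_betw_def intro: inj_on_subset)

text \<open>
  The canonical embedding carries the sumset, and likewise the difference set, of \<open>A\<close> to the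
  residues of the corresponding set of integer points.
\<close>

lemma card_sumset_residue_product:
  fixes m :: "nat \<Rightarrow> int"
  assumes m: "\<And>i. i \<in> {1..d} \<Longrightarrow> m i > 1" and A: "A \<subseteq> carrier (residue_product d m)"
  defines "P \<equiv> canonical_embedding d m ` A"
  shows "card (residue_vector d m ` sumset (integer_lattice d) P P)
    = card (sumset (residue_product d m) A A)"
proof -
  interpret group "residue_product d m" by (rule group_residue_product)
  let ?S = "sumset (residue_product d m) A A"
  let ?e = "canonical_embedding d m"
  have "?e ` ?S = (\<lambda>(a, b). ?e (a \<otimes>\<^bsub>residue_product d m\<^esub> b)) ` (A \<times> A)"
    by (auto simp: set_mult_def)
  also have "\<dots> = (\<lambda>(a, b). residue_vector d m (\<lambda>i\<in>{1..d}. ?e a i + ?e b i)) ` (A \<times> A)"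
  proof (rule image_cong, rule refl, clarify)
    fix a b assume "a \<in> A" "b \<in> A"
    then have ab: "a \<in> carrier (residue_product d m)" "b \<in> carrier (residue_product d m)"
      using A by auto
    show "?e (a \<otimes>\<^bsub>residue_product d m\<^esub> b)
      = residue_vector d m (\<lambda>i\<in>{1..d}. ?e a i + ?e b i)"
      using m ab by (rule canonical_embedding_mult)
  qed
  also have "\<dots> = {residue_vector d m (\<lambda>i\<in>{1..d}. ?e a i + ?e b i) | a b. a \<in> A \<and> b \<in> A}"
    by (auto simp del: One_nat_def)
  also have "\<dots> = residue_vector d m ` sumset (integer_lattice d) P P"
    unfolding sumset_integer_lattice P_def by blast
  finally have "?e ` ?S = residue_vector d m ` sumset (integer_lattice d) P P" .
  moreover have "card (?e ` ?S) = card ?S"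
    using m set_mult_closed[OF A A] by (rule card_canonical_embedding_image)
  ultimately show ?thesis by simp
qed

lemma card_diffset_residue_product:
  fixes m :: "nat \<Rightarrow> int"
  assumes m: "\<And>i. i \<in> {1..d} \<Longrightarrow> m i > 1" and A: "A \<subseteq> carrier (residue_product d m)"
  defines "P \<equiv> canonical_embedding d m ` A"
  shows "card (residue_vector d m ` diffset (integer_lattice d) P P)
    = card (diffset (residue_product d m) A A)"
proof -
  interpret group "residue_product d m" by (rule group_residue_product)
  let ?S = "diffset (residue_product d m) A A"
  let ?e = "canonical_embedding d m"
  have P: "P \<subseteq> extensional {1..d}"
    unfolding P_def by (rule canonical_embedding_subset_extensional)
  have "?e ` ?S
    = (\<lambda>(a, b). ?e (a \<otimes>\<^bsub>residue_product d m\<^esub> inv\<^bsub>residue_product d m\<^esub> b)) ` (A \<times> A)"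
    by (auto simp: diffset_def)
  also have "\<dots> = (\<lambda>(a, b). residue_vector d m (\<lambda>i\<in>{1..d}. ?e a i - ?e b i)) ` (A \<times> A)"
  proof (rule image_cong, rule refl, clarify)
    fix a b assume "a \<in> A" "b \<in> A"
    then have ab: "a \<in> carrier (residue_product d m)" "b \<in> carrier (residue_product d m)"
      using A by auto
    show "?e (a \<otimes>\<^bsub>residue_product d m\<^esub> inv\<^bsub>residue_product d m\<^esub> b)
      = residue_vector d m (\<lambda>i\<in>{1..d}. ?e a i - ?e b i)"
      using m ab by (rule canonical_embedding_mult_inv)
  qed
  also have "\<dots> = {residue_vector d m (\<lambda>i\<in>{1..d}. ?e a i - ?e b i) | a b. a \<in> A \<and> b \<in> A}"
    by (auto simp del: One_nat_def)
  also have "\<dots> = residue_vector d m ` diffset (integer_lattice d) P P"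
    unfolding diffset_integer_lattice[OF P] unfolding P_def by blast
  finally have "?e ` ?S = residue_vector d m ` diffset (integer_lattice d) P P" .
  moreover have "?S \<subseteq> carrier (residue_product d m)"
    using A by (auto simp: diffset_def)
  with m have "card (?e ` ?S) = card ?S"
    by (rule card_canonical_embedding_image)
  ultimately show ?thesis by simp
qed

section \<open>Sumsets and difference sets of the periodic lift\<close>

lemma periodic_liftE:
  assumes "x \<in> periodic_lift d m A t"
  obtains p q where "p \<in> canonical_embedding d m ` A" "\<forall>i\<in>{1..d}. 0 \<le> q i \<and> q i < t"
    "x = (\<lambda>i\<in>{1..d}. p i + q i * m i)"
proof -
  obtain p q where p: "p \<in> canonical_embedding d m ` A" "\<forall>i\<in>{1..d}. 0 \<le> q i \<and> q i < t"
    "x = (\<lambda>i\<in>{1..d}. p i + (\<lambda>i\<in>{1..d}. q i * m i) i)"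
    using assms unfolding periodic_lift_def sumset_integer_lattice period_lattice_box_def by blast
  have "x = (\<lambda>i\<in>{1..d}. p i + q i * m i)" unfolding p(3) by (rule restrict_ext) simp
  then show thesis using p that by blast
qed

lemma plus_box_memI:
  assumes "p \<in> X" "\<forall>i\<in>{1..d}. u \<le> q i \<and> q i < v"
  shows "(\<lambda>i\<in>{1..d}. p i + q i * m i)
    \<in> sumset (integer_lattice d) X (period_lattice_box d m u v)"
proof -
  have "(\<lambda>i\<in>{1..d}. p i + q i * m i) = (\<lambda>i\<in>{1..d}. p i + (\<lambda>i\<in>{1..d}. q i * m i) i)"
    by (rule restrict_ext) simp
  then show ?thesis
    using assms unfolding sumset_integer_lattice period_lattice_box_def by blast
qed

lemma sumset_periodic_lift_superset:
  fixes d :: nat and m :: "nat \<Rightarrow> int" and A :: "(nat \<Rightarrow> int set) set"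
  assumes "t \<ge> 1"
  defines "P \<equiv> canonical_embedding d m ` A"
  shows "sumset (integer_lattice d) (sumset (integer_lattice d) P P)
      (period_lattice_box d m 0 (2 * t - 1))
    \<subseteq> sumset (integer_lattice d) (periodic_lift d m A t) (periodic_lift d m A t)"
proof
  fix x assume "x \<in> sumset (integer_lattice d) (sumset (integer_lattice d) P P)
      (period_lattice_box d m 0 (2 * t - 1))"
  then obtain p p' q where p: "p \<in> P" "p' \<in> P"
    and q: "\<forall>i\<in>{1..d}. 0 \<le> q i \<and> q i < 2 * t - 1"
    and x: "x = (\<lambda>i\<in>{1..d}. (\<lambda>i\<in>{1..d}. p i + p' i) i + (\<lambda>i\<in>{1..d}. q i * m i) i)"
    unfolding sumset_integer_lattice period_lattice_box_def by blast
  \<comment> \<open>Every integer in \<open>[0, 2t - 2]\<close> is a sum of two integers in \<open>[0, t - 1]\<close>.\<close>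
  define r where "r i = min (q i) (t - 1)" for i
  define y where "y = (\<lambda>i\<in>{1..d}. p i + r i * m i)"
  define z where "z = (\<lambda>i\<in>{1..d}. p' i + (q i - r i) * m i)"
  have "\<forall>i\<in>{1..d}. 0 \<le> r i \<and> r i < t" "\<forall>i\<in>{1..d}. 0 \<le> q i - r i \<and> q i - r i < t"
    using q \<open>t \<ge> 1\<close> by (auto simp: r_def min_def)
  then have "y \<in> periodic_lift d m A t" "z \<in> periodic_lift d m A t"
    unfolding periodic_lift_def P_def[symmetric] y_def z_def
    by (auto simp del: One_nat_def intro!: plus_box_memI p)
  moreover have "x = (\<lambda>i\<in>{1..d}. y i + z i)"
    unfolding x y_def z_def by (rule restrict_ext) (simp add: algebra_simps)
  ultimately show "x \<in> sumset (integer_lattice d) (periodic_lift d m A t) (periodic_lift d m A t)"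
    unfolding sumset_integer_lattice by blast
qed

lemma diffset_periodic_lift_subset:
  fixes d :: nat and m :: "nat \<Rightarrow> int" and A :: "(nat \<Rightarrow> int set) set"
  defines "P \<equiv> canonical_embedding d m ` A"
  shows "diffset (integer_lattice d) (periodic_lift d m A t) (periodic_lift d m A t)
    \<subseteq> sumset (integer_lattice d) (diffset (integer_lattice d) P P)
      (period_lattice_box d m (1 - t) t)"
proof
  have P: "P \<subseteq> extensional {1..d}"
    unfolding P_def by (rule canonical_embedding_subset_extensional)
  have ext: "periodic_lift d m A t \<subseteq> extensional {1..d}"
    unfolding periodic_lift_def sumset_integer_lattice by auto
  fix x assume "x \<in> diffset (integer_lattice d) (periodic_lift d m A t) (periodic_lift d m A t)"
  then obtain y z where y: "y \<in> periodic_lift d m A t" and z: "z \<in> periodic_lift d m A t"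
    and x: "x = (\<lambda>i\<in>{1..d}. y i - z i)"
    unfolding diffset_integer_lattice[OF ext] by blast
  obtain p q where p: "p \<in> P" and q: "\<forall>i\<in>{1..d}. 0 \<le> q i \<and> q i < t"
    and y: "y = (\<lambda>i\<in>{1..d}. p i + q i * m i)"
    using periodic_liftE[OF y] unfolding P_def by metis
  obtain p' q' where p': "p' \<in> P" and q': "\<forall>i\<in>{1..d}. 0 \<le> q' i \<and> q' i < t"
    and z: "z = (\<lambda>i\<in>{1..d}. p' i + q' i * m i)"
    using periodic_liftE[OF z] unfolding P_def by metis
  have "(\<lambda>i\<in>{1..d}. p i - p' i) \<in> diffset (integer_lattice d) P P"
    unfolding diffset_integer_lattice[OF P] using p p' by blast
  moreover have "\<forall>i\<in>{1..d}. 1 - t \<le> q i - q' i \<and> q i - q' i < t"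
    using q q' by fastforce
  ultimately have "(\<lambda>i\<in>{1..d}. (\<lambda>i\<in>{1..d}. p i - p' i) i + (q i - q' i) * m i)
    \<in> sumset (integer_lattice d) (diffset (integer_lattice d) P P)
        (period_lattice_box d m (1 - t) t)"
    by (rule plus_box_memI)
  moreover have "x = (\<lambda>i\<in>{1..d}. (\<lambda>i\<in>{1..d}. p i - p' i) i + (q i - q' i) * m i)"
    unfolding x y z by (rule restrict_ext) (simp add: algebra_simps)
  ultimately show "x \<in> sumset (integer_lattice d) (diffset (integer_lattice d) P P)
      (period_lattice_box d m (1 - t) t)"
    by simp
qed

section \<open>Comparison of the two bounds\<close>

text \<open>
  By Bernoulli's inequality, \<open>((n - 1) / n)\<^sup>d\<close> is at least \<open>1 - d / n\<close>. The loss
  \<open>b d / n\<close> is less than 1, while \<open>b\<close> exceeds \<open>a\<close> by at least 1.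
\<close>

lemma power_ratio_bound:
  fixes a b d n :: nat
  assumes "a < b" and "n > d * b" and "n \<ge> 1"
  shows "a * n ^ d < b * (n - 1) ^ d"
proof -
  have n: "real n > 0" using \<open>n \<ge> 1\<close> by simp
  have "1 - real d / n \<le> (1 - 1 / n) ^ d"
    using Bernoulli_inequality[of "- (1 / real n)" d] n \<open>n \<ge> 1\<close> by (simp add: field_simps)
  then have bern: "b * (1 - real d / n) \<le> b * (1 - 1 / n) ^ d"
    by (rule mult_left_mono) simp
  have "real d * b < n" using \<open>n > d * b\<close> by (metis of_nat_less_iff of_nat_mult)
  then have "real d * b / n < 1" using n by simp
  moreover have "real a + 1 \<le> b" using \<open>a < b\<close> by simp
  ultimately have "a < b * (1 - real d / n)" by (simp add: algebra_simps)
  with bern have "a < b * (1 - 1 / real n) ^ d" by simp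
  then have "a * real n ^ d < b * (1 - 1 / real n) ^ d * real n ^ d"
    using n by (intro mult_strict_right_mono) auto
  also have "\<dots> = b * ((1 - 1 / real n) * n) ^ d" by (simp add: power_mult_distrib)
  also have "(1 - 1 / real n) * n = real (n - 1)"
    using n \<open>n \<ge> 1\<close> by (simp add: field_simps of_nat_diff)
  finally have "real (a * n ^ d) < real (b * (n - 1) ^ d)" by simp
  then show ?thesis by (simp only: of_nat_less_iff)
qed

theorem theorem8:
  fixes d :: nat and m :: "nat \<Rightarrow> int" and A :: "(nat \<Rightarrow> int set) set"
  assumes "d \<ge> 1"
    and "\<And>i. i \<in> {1..d} \<Longrightarrow> m i > 1"
    and "A \<subseteq> carrier (residue_product d m)"
    and "A \<noteq> {}"
    and "card (sumset (residue_product d m) A A) > card (diffset (residue_product d m) A A)"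
  shows "\<exists>t\<^sub>0 :: int. \<forall>t \<ge> t\<^sub>0.
    card (sumset (integer_lattice d) (periodic_lift d m A t) (periodic_lift d m A t))
    > card (diffset (integer_lattice d) (periodic_lift d m A t) (periodic_lift d m A t))"
proof (intro exI allI impI)
  note m = assms(2) and A = assms(3)
  have nonzero: "m i \<noteq> 0" if "i \<in> {1..d}" for i
    using m[OF that] by simp
  define P where "P = canonical_embedding d m ` A"
  let ?L = "integer_lattice d"
  let ?a = "card (diffset (residue_product d m) A A)"
  let ?b = "card (sumset (residue_product d m) A A)"
  fix t :: int
  assume t: "int (d * ?b) + 1 \<le> t"
  let ?B = "periodic_lift d m A t"
  have "t \<ge> 1" using t by linarith
  have "P \<subseteq> parallelepiped d m"
    using canonical_embedding_bij[of d m] m A by (auto simp: bij_betw_def P_def)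
  then have bounds: "0 \<le> p i" "p i < m i" if "p \<in> P" "i \<in> {1..d}" for p i
    using that unfolding parallelepiped_def by (fastforce simp: PiE_iff)+
  have "finite (parallelepiped d m)"
    unfolding parallelepiped_def by (rule finite_PiE) auto
  with \<open>P \<subseteq> parallelepiped d m\<close> have "finite P" by (rule finite_subset)
  have P: "P \<subseteq> extensional {1..d}"
    unfolding P_def by (rule canonical_embedding_subset_extensional)
  have finC: "finite (sumset ?L P P)"
    using \<open>finite P\<close> by (simp add: set_mult_def)
  have "diffset ?L P P = (\<lambda>(x, y). \<lambda>i\<in>{1..d}. x i - y i) ` (P \<times> P)"
    unfolding diffset_integer_lattice[OF P] by auto
  then have finD: "finite (diffset ?L P P)" using \<open>finite P\<close> by simp
  \<comment> \<open>A difference of two points of the parallelepiped lies strictly between \<open>- m i\<close> and \<open>m i\<close>.\<close>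
  have quot: "- 1 \<le> x i div m i \<and> x i div m i \<le> 0"
    if "x \<in> diffset ?L P P" and i: "i \<in> {1..d}" for x i
  proof -
    obtain p p' where p: "p \<in> P" "p' \<in> P" and x: "x i = p i - p' i"
      using \<open>x \<in> diffset ?L P P\<close> i unfolding diffset_integer_lattice[OF P] by auto
    have "- m i < x i" "x i < m i" using bounds[OF p(1) i] bounds[OF p(2) i] x by auto
    then have "- m i \<le> x i" "x i \<le> m i - 1" by simp_all
    then have "(- m i) div m i \<le> x i div m i" "x i div m i \<le> (m i - 1) div m i"
      using m[OF i] zdiv_mono1[of "- m i" "x i" "m i"] zdiv_mono1[of "x i" "m i - 1" "m i"]
      by linarith+
    moreover have "(- m i) div m i = - 1" "(m i - 1) div m i = 0"
      using m[OF i] by (simp_all add: zdiv_zminus1_eq_if)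
    ultimately show ?thesis by simp
  qed
  have cardC: "card (residue_vector d m ` sumset ?L P P) = ?b"
    unfolding P_def using m A by (rule card_sumset_residue_product)
  have cardD: "card (residue_vector d m ` diffset ?L P P) = ?a"
    unfolding P_def using m A by (rule card_diffset_residue_product)
  have "diffset ?L ?B ?B \<subseteq> sumset ?L (diffset ?L P P) (period_lattice_box d m (1 - t) t)"
    unfolding P_def by (rule diffset_periodic_lift_subset)
  with finD quot have "card (diffset ?L ?B ?B)
      \<le> card (residue_vector d m ` diffset ?L P P) * nat (t + 0 - ((1 - t) + (- 1))) ^ d"
    by (rule card_plus_box_le)
  also have "card (residue_vector d m ` diffset ?L P P) = ?a" by (rule cardD)
  also have "t + 0 - ((1 - t) + (- 1)) = 2 * t" by simp
  also have "?a * nat (2 * t) ^ d < ?b * (nat (2 * t) - 1) ^ d"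
  proof (rule power_ratio_bound)
    show "nat (2 * t) > d * ?b" "nat (2 * t) \<ge> 1" using t by linarith+
  qed (rule assms(5))
  also have "nat (2 * t) - 1 = nat (2 * t - 1 - 0)" by simp
  also have "?b * nat (2 * t - 1 - 0) ^ d
    \<le> card (sumset ?L (sumset ?L P P) (period_lattice_box d m 0 (2 * t - 1)))"
    unfolding cardC[symmetric] using nonzero finC by (rule card_residues_times_box_le)
  also have "\<dots> \<le> card (sumset ?L ?B ?B)"
  proof (rule card_mono)
    show "finite (sumset ?L ?B ?B)"
      using \<open>finite P\<close> finite_period_lattice_box
      by (simp add: periodic_lift_def set_mult_def flip: P_def)
  qed (rule sumset_periodic_lift_superset[OF \<open>t \<ge> 1\<close>, of d m A, folded P_def])
  finally show "card (diffset ?L ?B ?B) < card (sumset ?L ?B ?B)" .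
qed

end
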